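(* For every positive integer $n$ there exists a finite group $G$ such that $\Pr(G)=\frac1n$.
   Context: For a finite group $G$, $\Pr(G)=|\{(x,y)\in G\times G: xy=yx\}|/|G|^2$ is the commutativity degree. *)

theory Defs
  imports Complex_Main "HOL-Algebra.Coset"
begin

definition commutativity_degree :: "('a, 'b) monoid_scheme \<Rightarrow> real" where
  "commutativity_degree G =
     real (card {(x, y) \<in> carrier G \<times> carrier G. x \<otimes>\<^bsub>G\<^esub> y = y \<otimes>\<^bsub>G\<^esub> x})
       / (real (order G))\<^sup>2"

end

theory Submission
  imports Defs "HOL-Algebra.Weak_Morphisms"
begin

text \<open>
  Commutativity degrees are multiplicative under direct products, and the dihedral group
  \<open>D\<^sub>m\<close> of order \<open>2m\<close> with \<open>m\<close> odd has degree \<open>(m + 3) / (4m)\<close>. The value \<open>1/n\<close> is reached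
  by strong induction on \<open>n\<close>, multiplying the group for a smaller index by a dihedral group:

  \<^item> \<open>n = 2k\<close>: \<open>D\<^sub>3\<close> has degree \<open>1/2\<close>, and \<open>1/2 \<cdot> 1/k = 1/n\<close>;

  \<^item> \<open>n = 4k + 1 > 1\<close>: \<open>D\<^sub>n\<close> has degree \<open>(n + 3)/(4n) = (k + 1)/n\<close>;

  \<^item> \<open>n = 4k + 3\<close>: \<open>D\<^sub>3\<^sub>n\<close> has degree \<open>(3n + 3)/(12n) = (k + 1)/n\<close>.

  In the last two cases the other factor has degree \<open>1/(k + 1)\<close>, where \<open>k + 1 < n\<close>. Every
  finite group is isomorphic to one whose elements are natural numbers, so products can be
  brought back to that type.
\<close>

lemma commutativity_degree_iso:
  assumes "monoid G" and h: "h \<in> iso G H"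
  shows "commutativity_degree H = commutativity_degree G"
proof -
  interpret G: monoid G by fact
  have bij: "bij_betw h (carrier G) (carrier H)" using h by (simp add: iso_def)
  have hm: "h (x \<otimes>\<^bsub>G\<^esub> y) = h x \<otimes>\<^bsub>H\<^esub> h y" if "x \<in> carrier G" "y \<in> carrier G" for x y
    using h that by (simp add: iso_def hom_def)
  have inj: "inj_on h (carrier G)" and im: "h ` carrier G = carrier H"
    using bij by (auto simp: bij_betw_def)
  have comm: "h x \<otimes>\<^bsub>H\<^esub> h y = h y \<otimes>\<^bsub>H\<^esub> h x \<longleftrightarrow> x \<otimes>\<^bsub>G\<^esub> y = y \<otimes>\<^bsub>G\<^esub> x"
    if "x \<in> carrier G" "y \<in> carrier G" for x y
    using inj_on_eq_iff[OF inj, of "x \<otimes>\<^bsub>G\<^esub> y" "y \<otimes>\<^bsub>G\<^esub> x"] that by (simp add: hm)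
  have "{(x, y) \<in> carrier H \<times> carrier H. x \<otimes>\<^bsub>H\<^esub> y = y \<otimes>\<^bsub>H\<^esub> x} =
      map_prod h h ` {(x, y) \<in> carrier G \<times> carrier G. x \<otimes>\<^bsub>G\<^esub> y = y \<otimes>\<^bsub>G\<^esub> x}" (is "?B = _ ` ?A")
  proof
    show "map_prod h h ` ?A \<subseteq> ?B" using im comm by auto
    show "?B \<subseteq> map_prod h h ` ?A"
    proof clarify
      fix u v assume "u \<in> carrier H" "v \<in> carrier H" and c: "u \<otimes>\<^bsub>H\<^esub> v = v \<otimes>\<^bsub>H\<^esub> u"
      then obtain x y where xy: "x \<in> carrier G" "y \<in> carrier G" "u = h x" "v = h y"
        using im by blast
      then have "(x, y) \<in> ?A" using c comm by simp
      then show "(u, v) \<in> map_prod h h ` ?A" using xy by force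
    qed
  qed
  moreover have "inj_on (map_prod h h) ?A"
    by (rule inj_on_subset[OF map_prod_inj_on[OF inj inj]]) auto
  ultimately have "card ?B = card ?A" by (simp add: card_image)
  moreover have "order H = order G"
    using bij by (simp add: order_def bij_betw_same_card)
  ultimately show ?thesis by (simp add: commutativity_degree_def)
qed

lemma commutativity_degree_DirProd:
  "commutativity_degree (G \<times>\<times> H) = commutativity_degree G * commutativity_degree H"
proof -
  let ?C = "\<lambda>K. {(x, y) \<in> carrier K \<times> carrier K. x \<otimes>\<^bsub>K\<^esub> y = y \<otimes>\<^bsub>K\<^esub> x}"
  have "bij_betw (\<lambda>((a, b), (c, d)). ((a, c), (b, d))) (?C G \<times> ?C H) (?C (G \<times>\<times> H))"
    by (rule bij_betw_byWitness[where f' = "\<lambda>((a, b), (c, d)). ((a, c), (b, d))"]) auto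
  from bij_betw_same_card[OF this] have "card (?C (G \<times>\<times> H)) = card (?C G) * card (?C H)"
    unfolding card_cartesian_product by (rule sym)
  then show ?thesis
    by (simp add: commutativity_degree_def order_def DirProd_def card_cartesian_product
        power_mult_distrib)
qed

lemma finite_group_iso_nat:
  fixes G :: "('a, 'b) monoid_scheme"
  assumes "group G" "finite (carrier G)"
  obtains H :: "nat monoid" and h where "group H" "finite (carrier H)" "h \<in> iso G H"
proof -
  interpret G: group G by fact
  obtain h :: "'a \<Rightarrow> nat" where inj: "inj_on h (carrier G)"
    using finite_imp_inj_to_nat_seg[OF assms(2)] by blast
  have "group (image_group h G)"
    by (rule G.inj_imp_image_group_is_group[OF inj])
  moreover have "finite (carrier (image_group h G))"
    using assms(2) by (simp add: image_group_def)
  moreover have "h \<in> iso G (image_group h G)"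
    by (rule inj_imp_image_group_iso[OF inj])
  ultimately show thesis using that by blast
qed

text \<open>
  The dihedral group of order \<open>2m\<close>: the pair \<open>(a, s)\<close> stands for the map
  \<open>x \<mapsto> a + x\<close> (a rotation, \<open>s\<close> false) or \<open>x \<mapsto> a - x\<close> (a reflection, \<open>s\<close> true) on the integers modulo \<open>m\<close>,
  whose elements are represented by their residues \<open>0, \<dots>, m - 1\<close>.
\<close>

definition dihedral :: "int \<Rightarrow> (int \<times> bool) monoid" where
  "dihedral m = \<lparr>carrier = {0..<m} \<times> UNIV,
    mult = (\<lambda>(a, s) (b, t). ((if s then a - b else a + b) mod m, s \<noteq> t)),
    one = (0, False)\<rparr>"

lemma group_dihedral:
  assumes "m > 0"
  shows "group (dihedral m)"
proof (rule groupI)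
  fix x y z
  show "x \<otimes>\<^bsub>dihedral m\<^esub> y \<otimes>\<^bsub>dihedral m\<^esub> z = x \<otimes>\<^bsub>dihedral m\<^esub> (y \<otimes>\<^bsub>dihedral m\<^esub> z)"
    by (cases x; cases y; cases z)
      (simp add: dihedral_def mod_simps algebra_simps split: if_splits)
next
  fix x assume x: "x \<in> carrier (dihedral m)"
  obtain a s where [simp]: "x = (a, s)" by force
  have "(if s then a else (- a) mod m, s) \<otimes>\<^bsub>dihedral m\<^esub> x = \<one>\<^bsub>dihedral m\<^esub>"
    by (simp add: dihedral_def mod_simps)
  moreover have "(if s then a else (- a) mod m, s) \<in> carrier (dihedral m)"
    using x assms by (simp add: dihedral_def)
  ultimately show "\<exists>y\<in>carrier (dihedral m). y \<otimes>\<^bsub>dihedral m\<^esub> x = \<one>\<^bsub>dihedral m\<^esub>" by blast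
qed (use assms in \<open>auto simp: dihedral_def\<close>)

lemma finite_dihedral: "finite (carrier (dihedral m))"
  by (simp add: dihedral_def)

text \<open>
  For odd \<open>m\<close>, two rotations always commute, a rotation commutes with a reflection exactly when
  the rotation is trivial, and two reflections commute exactly when they are equal; this gives
  \<open>m\<^sup>2 + m + m + m\<close> commuting pairs among the \<open>(2m)\<^sup>2\<close> pairs.
\<close>

lemma commutativity_degree_dihedral:
  assumes m: "m > 0" "odd m"
  shows "commutativity_degree (dihedral m) = (of_int m + 3) / (4 * of_int m)"
proof -
  let ?Z = "{0..<m}"
  have cancel: "a = b" if "a \<in> ?Z" "b \<in> ?Z" "m dvd 2 * (a - b)" for a b
  proof -
    have "coprime m 2" using m by simp
    then have "m dvd a - b" using that(3) coprime_dvd_mult_right_iff by blast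
    then show ?thesis using that
      by (metis atLeastLessThan_iff mod_eq_dvd_iff mod_pos_pos_trivial)
  qed
  have rot_refl: "(a + b) mod m = (b - a) mod m \<longleftrightarrow> a = 0" if "a \<in> ?Z" for a b
    using cancel[of a 0] that m by (auto simp: mod_eq_dvd_iff)
  have refl_rot: "(a - b) mod m = (b + a) mod m \<longleftrightarrow> b = 0" if "b \<in> ?Z" for a b
    using rot_refl[of b a] that by auto
  have refl_refl: "(a - b) mod m = (b - a) mod m \<longleftrightarrow> a = b" if "a \<in> ?Z" "b \<in> ?Z" for a b
    using cancel[of a b] that by (auto simp: mod_eq_dvd_iff algebra_simps)
  let ?C = "{(x, y) \<in> carrier (dihedral m) \<times> carrier (dihedral m).
    x \<otimes>\<^bsub>dihedral m\<^esub> y = y \<otimes>\<^bsub>dihedral m\<^esub> x}"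
  \<comment> \<open>The commuting pairs, sorted by whether each of the two elements is a reflection.\<close>
  define P where "P s t = {((a, s), (b, t)) |a b. a \<in> ?Z \<and> b \<in> ?Z \<and>
    (a, s) \<otimes>\<^bsub>dihedral m\<^esub> (b, t) = (b, t) \<otimes>\<^bsub>dihedral m\<^esub> (a, s)}" for s t
  have C: "?C = (P False False \<union> P False True) \<union> (P True False \<union> P True True)"
    by (auto simp: P_def dihedral_def)
  have FF: "P False False = (\<lambda>(a, b). ((a, False), (b, False))) ` (?Z \<times> ?Z)"
    by (auto simp: P_def dihedral_def add.commute)
  have FT: "P False True = (\<lambda>b. ((0, False), (b, True))) ` ?Z"
    using m(1) by (auto simp: P_def dihedral_def rot_refl)
  have TF: "P True False = (\<lambda>b. ((b, True), (0, False))) ` ?Z"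
    using m(1) by (auto simp: P_def dihedral_def refl_rot)
  have TT: "P True True = (\<lambda>b. ((b, True), (b, True))) ` ?Z"
    by (auto simp: P_def dihedral_def refl_refl)
  have cards: "card (P False False) = nat m * nat m" "card (P False True) = nat m"
      "card (P True False) = nat m" "card (P True True) = nat m"
    unfolding FF FT TF TT by (subst card_image; auto simp: inj_on_def)+
  have fin: "finite (P s t)" for s t
    by (cases s; cases t) (simp_all add: FF FT TF TT)
  have disj: "P False False \<inter> P False True = {}" "P True False \<inter> P True True = {}"
      "(P False False \<union> P False True) \<inter> (P True False \<union> P True True) = {}"
    by (auto simp: P_def)
  have "card ?C = nat m * nat m + nat m + (nat m + nat m)"
    unfolding C by (simp add: card_Un_disjoint fin disj cards)
  moreover have "order (dihedral m) = 2 * nat m"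
    by (simp add: order_def dihedral_def card_cartesian_product)
  ultimately show ?thesis using m(1)
    by (simp add: commutativity_degree_def field_simps power2_eq_square)
qed

lemma ex_group_with_degree_mult:
  fixes G :: "nat monoid" and K :: "'a monoid"
  assumes "group G" "finite (carrier G)" "group K" "finite (carrier K)"
  shows "\<exists>H :: nat monoid. group H \<and> finite (carrier H) \<and>
    commutativity_degree H = commutativity_degree K * commutativity_degree G"
proof -
  have grp: "group (K \<times>\<times> G)" using assms by (simp add: DirProd_group)
  moreover have "finite (carrier (K \<times>\<times> G))" using assms by (simp add: DirProd_def)
  ultimately obtain H :: "nat monoid" and h
    where "group H" "finite (carrier H)" "h \<in> iso (K \<times>\<times> G) H"
    by (rule finite_group_iso_nat)
  then show ?thesis
    using commutativity_degree_iso[OF group.is_monoid[OF grp]]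
    by (metis commutativity_degree_DirProd)
qed

theorem proposition2p5p2:
  fixes n :: nat
  assumes "n > 0"
  shows "\<exists>G :: nat monoid. group G \<and> finite (carrier G) \<and> commutativity_degree G = 1 / real n"
  using assms
proof (induction n rule: less_induct)
  case (less n)
  \<comment> \<open>It suffices that the dihedral group of some odd \<open>m\<close> has degree \<open>k / n\<close> with \<open>0 < k < n\<close>;
    the condition is stated without denominators.\<close>
  have step: ?case
    if "0 < k" "k < n" and m: "0 < m" "odd m"
      and eq: "(real_of_int m + 3) * real n = 4 * real_of_int m * real k" for k m
  proof -
    have "(real_of_int m + 3) / (4 * real_of_int m * real k) = 1 / real n"
      using that less.prems by (simp add: frac_eq_eq)
    moreover
    obtain G :: "nat monoid" where "group G" "finite (carrier G)"
      "commutativity_degree G = 1 / real k"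
      using less.IH[OF \<open>k < n\<close> \<open>0 < k\<close>] by blast
    ultimately show ?thesis
      using ex_group_with_degree_mult[OF _ _ group_dihedral[OF m(1)] finite_dihedral, of G]
      by (simp add: commutativity_degree_dihedral[OF m])
  qed
  consider "n = 1" | k where "n = 2 * k" | k where "n = 4 * k + 1" "k > 0" | k where "n = 4 * k + 3"
  proof -
    have "n = 2 * (n div 2) \<or> n = 4 * (n div 4) + 1 \<or> n = 4 * (n div 4) + 3" by presburger
    then show thesis using that by (metis add_0 gr0I mult_0_right)
  qed
  then show ?case
  proof cases
    case 1
    let ?T = "\<lparr>carrier = {0}, mult = (\<lambda>_ _. 0), one = 0\<rparr> :: nat monoid"
    have "group ?T" by (rule groupI) auto
    moreover have "{(x, y) \<in> carrier ?T \<times> carrier ?T. x \<otimes>\<^bsub>?T\<^esub> y = y \<otimes>\<^bsub>?T\<^esub> x} = {(0, 0)}" by auto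
    then have "commutativity_degree ?T = 1 / real n"
      using 1 by (simp add: commutativity_degree_def order_def)
    ultimately show ?thesis by (intro exI[of _ ?T]) simp
  next
    case (2 k)
    then show ?thesis using step[of k 3] less.prems by simp
  next
    case (3 k)
    then show ?thesis using step[of "k + 1" "int n"] by (simp add: algebra_simps)
  next
    case (4 k)
    then show ?thesis using step[of "k + 1" "3 * int n"] by (simp add: algebra_simps)
  qed
qed

end
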